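(* Let $j^{\operatorname{last}}_{m,k}(231)$ be the number of $231$-avoiding Jacobi permutations $\pi\in\mathfrak{S}_m$ whose last letter equals $k$. For all $n,k\geq1$, \[ j^{\operatorname{last}}_{2n,k}(231)=\sum_{m=0}^{n-1}\frac{n+k-3m-1}{n+k-1}\binom{n-m-1}{k-2m-1}\binom{n+k-1}{m} \] and \[ j^{\operatorname{last}}_{2n+1,k}(231)=\sum_{m=0}^{n-1}\frac{n+k-3m-1}{n+k-1}\binom{n-m}{k-2m-1}\binom{n+k-1}{m}. \]
   Context: A permutation of a finite set $S$ of positive integers is a word in which each element of $S$ appears exactly once; $\mathfrak{S}_m$ is the set of permutations of $\{1,\dots,m\}$. For a permutation $\pi$ and a letter $x$ of $\pi$, $\rho_\pi(x)$ is the maximal consecutive subword of $\pi$ consisting of the letters immediately to the right of $x$ that are all larger than $x$. $\pi$ is Jacobi if $|\rho_\pi(x)|$ is even for all letters $x$. A permutation $\pi$ avoids a pattern $\sigma$ if no subword of $\pi$ has standardization (relative order) $\sigma$. Binomial coefficients $\binom{a}{b}$ are $0$ when $b<0$ or $b>a$. *)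

theory Defs
  imports Complex_Main "HOL-Combinatorics.Multiset_Permutations" "HOL-Library.Sublist"
begin

text \<open>A permutation of a finite set \<open>S\<close> of positive integers is a word, i.e. an element of
  \<open>permutations_of_set S\<close>.\<close>

definition rho :: "nat list \<Rightarrow> nat \<Rightarrow> nat list" where
  "rho \<pi> x = takeWhile (\<lambda>y. x < y) (tl (dropWhile (\<lambda>y. y \<noteq> x) \<pi>))"

definition jacobi :: "nat list \<Rightarrow> bool" where
  "jacobi \<pi> \<longleftrightarrow> (\<forall>x\<in>set \<pi>. even (length (rho \<pi> x)))"

definition standardization :: "nat list \<Rightarrow> nat list" where
  "standardization w = map (\<lambda>x. card {y \<in> set w. y \<le> x}) w"

text \<open>Subwords in pattern avoidance need not be consecutive.\<close>

definition avoids :: "nat list \<Rightarrow> nat list \<Rightarrow> bool" where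
  "avoids \<pi> \<sigma> \<longleftrightarrow> \<not> (\<exists>w. subseq w \<pi> \<and> standardization w = \<sigma>)"

definition jlast :: "nat list \<Rightarrow> nat \<Rightarrow> nat \<Rightarrow> nat" where
  "jlast \<sigma> m k =
     card {\<pi> \<in> permutations_of_set {1..m}.
             jacobi \<pi> \<and> avoids \<pi> \<sigma> \<and> \<pi> \<noteq> [] \<and> last \<pi> = k}"

text \<open>The lower index of a binomial coefficient may be negative, so truncated subtraction on
  \<open>nat\<close> must be avoided.\<close>

definition int_binomial :: "int \<Rightarrow> int \<Rightarrow> nat" where
  "int_binomial a b = (if b < 0 \<or> b > a then 0 else nat a choose nat b)"

end

theory Submission
  imports Defs "HOL-Computational_Algebra.Polynomial" "HOL-Computational_Algebra.Formal_Power_Series"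
begin

text \<open>
  A \<open>231\<close>-avoiding word with first letter \<open>f\<close> has the form \<open>f # u @ v\<close>, where \<open>u\<close> consists of
  the letters below \<open>f\<close> and \<open>v\<close> of those above. All of \<open>f # u\<close> lies below \<open>v\<close>, so the run \<open>rho\<close>
  of the last letter of \<open>f # u\<close> is all of \<open>v\<close>, and the word is Jacobi iff \<open>u\<close> and \<open>v\<close> are Jacobi
  and \<open>v\<close> has even length. Let \<open>x\<close> mark half the length (rounded down), let \<open>e\<close> be the series of
  the words of even length weighted by \<open>t ^ length\<close>, and let \<open>P\<close> and \<open>Q\<close> be the series of the words
  of even and odd length weighted by \<open>t ^ last\<close>. The decomposition gives \<open>e = 1 + x t\<^sup>2 e\<^sup>3\<close>,
  \<open>Q = t + (1 + t e) P\<close> and \<open>P = x (t\<^sup>2 e\<^sup>2 P + Q)\<close>. The first and third equations combine to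
  \<open>P = x e Q\<close>, so that \<open>Q = t + x e (1 + t e) Q\<close>. The formulas follow by expanding the geometric
  series for \<open>Q\<close>, the powers of \<open>1 + t e\<close>, and the powers of \<open>e\<close>, whose coefficients are Raney
  numbers.
\<close>

section \<open>Pattern avoidance\<close>

lemma subseq_imp_set_subset: "subseq v w \<Longrightarrow> set v \<subseteq> set w"
  by (auto simp: subseq_conv_nths dest: in_set_nthsD)

lemma subseq_map_iff: "subseq v (map f w) \<longleftrightarrow> (\<exists>u. subseq u w \<and> v = map f u)"
  by (auto simp: subseq_conv_nths nths_map)

lemma standardization_map:
  assumes "strict_mono f"
  shows "standardization (map f w) = standardization w"
proof -
  have "card {y \<in> f ` set w. y \<le> f x} = card {y \<in> set w. y \<le> x}" for x
  proof -
    have "{y \<in> f ` set w. y \<le> f x} = f ` {y \<in> set w. y \<le> x}"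
      using strict_mono_less_eq[OF assms] by auto
    then show ?thesis
      using strict_mono_on_imp_inj_on[OF assms] by (simp add: card_image inj_on_subset)
  qed
  then show ?thesis by (simp add: standardization_def)
qed

lemma avoids_map_iff: "strict_mono f \<Longrightarrow> avoids (map f w) \<sigma> \<longleftrightarrow> avoids w \<sigma>"
  by (auto simp: avoids_def subseq_map_iff standardization_map)

lemma standardization_eq_231_iff:
  "standardization w = [2,3,1] \<longleftrightarrow> (\<exists>a b c. w = [a,b,c] \<and> c < a \<and> a < b)"
proof
  assume w_std: "standardization w = [2,3,1]"
  then have "length w = 3"
    unfolding standardization_def by (auto dest: arg_cong[of _ _ length])
  then obtain a b c where w: "w = [a,b,c]"
    by (auto simp: numeral_3_eq_3 length_Suc_conv)
  have rank: "card {y \<in> set w. y \<le> a} = 2" "card {y \<in> set w. y \<le> b} = 3"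
    "card {y \<in> set w. y \<le> c} = 1"
    using w_std w by (auto simp: standardization_def)
  have less: "x < y" if "card {z \<in> set w. z \<le> x} < card {z \<in> set w. z \<le> y}" for x y
  proof (rule ccontr)
    assume "\<not> x < y"
    then have "card {z \<in> set w. z \<le> y} \<le> card {z \<in> set w. z \<le> x}"
      by (intro card_mono) auto
    with that show False by simp
  qed
  from less[of c a] less[of a b] rank w
  show "\<exists>a b c. w = [a,b,c] \<and> c < a \<and> a < b" by auto
next
  assume "\<exists>a b c. w = [a,b,c] \<and> c < a \<and> a < b"
  then obtain a b c where w: "w = [a,b,c]" "c < a" "a < b" by blast
  then have "{y \<in> {a,b,c}. y \<le> a} = {a,c}" "{y \<in> {a,b,c}. y \<le> b} = {a,b,c}"
    "{y \<in> {a,b,c}. y \<le> c} = {c}" by auto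
  then show "standardization w = [2,3,1]"
    using w by (simp add: standardization_def)
qed

lemma avoids_231_iff: "avoids w [2,3,1] \<longleftrightarrow> \<not> (\<exists>a b c. subseq [a,b,c] w \<and> c < a \<and> a < b)"
  unfolding avoids_def standardization_eq_231_iff by blast

lemma avoids_231_append_iff:
  assumes "\<forall>x\<in>set u. \<forall>y\<in>set v. x < y"
  shows "avoids (u @ v) [2,3,1] \<longleftrightarrow> avoids u [2,3,1] \<and> avoids v [2,3,1]"
proof -
  have "subseq [a,b,c] (u @ v) \<longleftrightarrow> subseq [a,b,c] u \<or> subseq [a,b,c] v" if "c < a" for a b c
  proof
    assume "subseq [a,b,c] (u @ v)"
    then obtain xs ys where split: "[a,b,c] = xs @ ys" and "subseq xs u" "subseq ys v"
      unfolding subseq_append_iff by blast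
    then have subsets: "set xs \<subseteq> set u" "set ys \<subseteq> set v"
      by (simp_all add: subseq_imp_set_subset)
    have "xs = [] \<or> ys = []"
    proof (rule ccontr)
      assume nonempty: "\<not> (xs = [] \<or> ys = [])"
      then have "a = hd xs" "c = last ys"
        using arg_cong[OF split, of hd] arg_cong[OF split, of last] by simp_all
      with nonempty subsets have "a \<in> set u" "c \<in> set v" by auto
      with assms \<open>c < a\<close> show False by fastforce
    qed
    with split \<open>subseq xs u\<close> \<open>subseq ys v\<close> show "subseq [a,b,c] u \<or> subseq [a,b,c] v"
      by (elim disjE) simp_all
  qed (auto intro: subseq_drop_many subseq_rev_drop_many)
  then show ?thesis unfolding avoids_231_iff by metis
qed

lemma eq_filter_append_filter_not_iff:
  "w = filter P w @ filter (\<lambda>x. \<not> P x) w \<longleftrightarrow> (\<forall>b c. subseq [b,c] w \<longrightarrow> P c \<longrightarrow> P b)"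
proof (induction w)
  case (Cons x w)
  have "subseq [b,c] (x # w) \<longleftrightarrow> subseq [b,c] w \<or> b = x \<and> c \<in> set w" for b c
    using subseq_Cons'[of b "[c]" w] by (auto simp: subseq_singleton_left)
  then have pairs: "(\<forall>b c. subseq [b,c] (x # w) \<longrightarrow> P c \<longrightarrow> P b) \<longleftrightarrow>
      (\<forall>b c. subseq [b,c] w \<longrightarrow> P c \<longrightarrow> P b) \<and> (P x \<or> (\<forall>c\<in>set w. \<not> P c))"
    by blast
  have "x # w = filter P w @ x # filter (\<lambda>x. \<not> P x) w \<longleftrightarrow> (\<forall>c\<in>set w. \<not> P c)"
    if "\<not> P x"
  proof (cases "filter P w")
    case Nil
    then have "\<forall>c\<in>set w. \<not> P c" by (simp add: filter_empty_conv)
    with Nil show ?thesis by simp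
  next
    case (Cons y ys)
    then have "y \<in> set w" "P y" by (auto dest: filter_eq_ConsD)
    with Cons that show ?thesis by auto
  qed
  with Cons.IH show ?case unfolding pairs by auto
qed simp

lemma avoids_231_Cons_iff:
  assumes "f \<notin> set w"
  shows "avoids (f # w) [2,3,1] \<longleftrightarrow>
    avoids w [2,3,1] \<and> w = filter (\<lambda>x. x < f) w @ filter (\<lambda>x. f < x) w"
proof -
  have "subseq [a,b,c] (f # w) \<longleftrightarrow> (a = f \<and> subseq [b,c] w) \<or> subseq [a,b,c] w" for a b c
    using subseq_Cons'[of a "[b,c]" w] by (cases "a = f") auto
  then have "avoids (f # w) [2,3,1] \<longleftrightarrow>
      avoids w [2,3,1] \<and> (\<forall>b c. subseq [b,c] w \<longrightarrow> c < f \<longrightarrow> \<not> f < b)"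
    unfolding avoids_231_iff by metis
  also have "(\<forall>b c. subseq [b,c] w \<longrightarrow> c < f \<longrightarrow> \<not> f < b) \<longleftrightarrow>
      (\<forall>b c. subseq [b,c] w \<longrightarrow> c < f \<longrightarrow> b < f)"
  proof -
    have "b \<noteq> f" if "subseq [b,c] w" for b c
      using subseq_imp_set_subset[OF that] assms by auto
    then show ?thesis by (metis linorder_neqE_nat order_less_asym)
  qed
  also have "\<dots> \<longleftrightarrow> w = filter (\<lambda>x. x < f) w @ filter (\<lambda>x. \<not> x < f) w"
    by (rule eq_filter_append_filter_not_iff[symmetric])
  also have "filter (\<lambda>x. \<not> x < f) w = filter (\<lambda>x. f < x) w"
    using assms by (intro filter_cong) (auto simp: not_less le_less)
  finally show ?thesis .
qed

section \<open>Jacobi words\<close>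

lemma rho_Cons: "rho (f # w) x = (if x = f then takeWhile (\<lambda>y. x < y) w else rho w x)"
  by (auto simp: rho_def)

lemma rho_map:
  assumes "strict_mono f"
  shows "rho (map f w) (f x) = map f (rho w x)"
  using strict_mono_less[OF assms] strict_mono_eq[OF assms]
  by (induction w) (auto simp: rho_Cons takeWhile_map comp_def, simp add: rho_def)

lemma jacobi_map_iff: "strict_mono f \<Longrightarrow> jacobi (map f w) \<longleftrightarrow> jacobi w"
  by (simp add: jacobi_def rho_map)

lemma jacobi_Nil [simp]: "jacobi []"
  by (simp add: jacobi_def)

lemma jacobi_Cons_iff:
  assumes "f \<notin> set w"
  shows "jacobi (f # w) \<longleftrightarrow> even (length (takeWhile (\<lambda>y. f < y) w)) \<and> jacobi w"
  using assms by (auto simp: jacobi_def rho_Cons)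

lemma jacobi_append_iff:
  assumes "distinct u" "u \<noteq> []" "\<forall>x\<in>set u. \<forall>y\<in>set v. x < y"
  shows "jacobi (u @ v) \<longleftrightarrow> even (length v) \<and> jacobi u \<and> jacobi v"
  using assms(2,1,3)
proof (induction u rule: list_nonempty_induct)
  case (single x)
  then have "x \<notin> set v" by fastforce
  with single show ?case
    by (simp add: jacobi_Cons_iff takeWhile_eq_all_conv[THEN iffD2])
next
  case (cons x u)
  then have "x \<notin> set (u @ v)" by auto
  moreover have "even (length (takeWhile (\<lambda>y. x < y) (u @ v))) \<longleftrightarrow>
      even (length (takeWhile (\<lambda>y. x < y) u))" if "even (length v)"
    using cons.prems that
    by (auto simp: takeWhile_append takeWhile_eq_all_conv[THEN iffD2])
  ultimately show ?case
    using cons by (auto simp: jacobi_Cons_iff)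
qed

definition jacobi_231 :: "nat set \<Rightarrow> nat list set" where
  "jacobi_231 S = {\<pi> \<in> permutations_of_set S. jacobi \<pi> \<and> avoids \<pi> [2,3,1]}"

lemma finite_jacobi_231 [simp]: "finite (jacobi_231 S)"
  by (simp add: jacobi_231_def)

lemma jacobi_231_empty [simp]: "jacobi_231 {} = {[]}"
  using avoids_231_iff[of "[]"] by (auto simp: jacobi_231_def)

lemma set_jacobi_231: "w \<in> jacobi_231 S \<Longrightarrow> set w = S"
  by (simp add: jacobi_231_def permutations_of_set_def)

lemma length_jacobi_231: "w \<in> jacobi_231 S \<Longrightarrow> length w = card S"
  by (auto simp: jacobi_231_def length_finite_permutations_of_set)

lemma jacobi_231_image:
  assumes "strict_mono f"
  shows "jacobi_231 (f ` S) = map f ` jacobi_231 S"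
  using permutations_of_set_image_inj[OF inj_on_subset[OF strict_mono_on_imp_inj_on[OF assms] subset_UNIV]]
  by (auto simp: jacobi_231_def jacobi_map_iff[OF assms] avoids_map_iff[OF assms])

lemma jacobi_231_Cons_append_iff:
  assumes "\<forall>x\<in>set u. x < f" "\<forall>y\<in>set v. f < y"
  shows "f # u @ v \<in> jacobi_231 S \<longleftrightarrow> f \<in> S \<and> even (length v) \<and>
    u \<in> jacobi_231 {x \<in> S. x < f} \<and> v \<in> jacobi_231 {x \<in> S. f < x}"
proof (cases "distinct u")
  case True
  have "f \<notin> set u" and below: "\<forall>x\<in>set (f # u). \<forall>y\<in>set v. x < y" using assms by fastforce+
  have "filter (\<lambda>x. x < f) u = u" "filter (\<lambda>x. f < x) u = []"
    using assms(1) by (auto simp: filter_id_conv filter_empty_conv)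
  then have "avoids (f # u @ v) [2,3,1] \<longleftrightarrow> avoids u [2,3,1] \<and> avoids v [2,3,1]"
    using avoids_231_append_iff[OF below] avoids_231_Cons_iff[OF \<open>f \<notin> set u\<close>] by simp
  moreover have "takeWhile (\<lambda>y. f < y) u = []"
    using assms(1) by (cases u) auto
  then have "jacobi (f # u @ v) \<longleftrightarrow> even (length v) \<and> jacobi u \<and> jacobi v"
    using jacobi_append_iff[OF _ _ below] jacobi_Cons_iff[OF \<open>f \<notin> set u\<close>] True \<open>f \<notin> set u\<close>
    by simp
  moreover have "f # u @ v \<in> permutations_of_set S \<longleftrightarrow> f \<in> S \<and>
      u \<in> permutations_of_set {x \<in> S. x < f} \<and> v \<in> permutations_of_set {x \<in> S. f < x}"
    using assms unfolding permutations_of_set_def by fastforce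
  ultimately show ?thesis by (auto simp: jacobi_231_def)
qed (auto simp: jacobi_231_def permutations_of_set_def)

lemma jacobi_231_Cons_eq_append:
  assumes "f # r \<in> jacobi_231 S"
  shows "r = filter (\<lambda>x. x < f) r @ filter (\<lambda>x. f < x) r"
  using assms avoids_231_Cons_iff[of f r] by (simp add: jacobi_231_def permutations_of_set_def)

lemma bij_betw_jacobi_231_first_letter:
  assumes "S \<noteq> {}"
  shows "bij_betw (\<lambda>(f,u,v). f # u @ v)
    (SIGMA f:{f \<in> S. even (card {x \<in> S. f < x})}.
      jacobi_231 {x \<in> S. x < f} \<times> jacobi_231 {x \<in> S. f < x})
    (jacobi_231 S)" (is "bij_betw ?join ?D _")
proof -
  define split where "split w =
    (hd w, filter (\<lambda>x. x < hd w) (tl w), filter (\<lambda>x. hd w < x) (tl w))" for w :: "nat list"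
  have split_join: "split (?join p) = p \<and> ?join p \<in> jacobi_231 S" if "p \<in> ?D" for p
  proof -
    from that obtain f u v where p: "p = (f, u, v)" "f \<in> S" "even (card {x \<in> S. f < x})"
      and uv: "u \<in> jacobi_231 {x \<in> S. x < f}" "v \<in> jacobi_231 {x \<in> S. f < x}" by blast
    then have bounds: "\<forall>x\<in>set u. x < f" "\<forall>y\<in>set v. f < y" by (auto dest: set_jacobi_231)
    then have "filter (\<lambda>x. x < f) (u @ v) = u" "filter (\<lambda>x. f < x) (u @ v) = v"
      by (force simp: filter_id_conv filter_empty_conv)+
    moreover have "f # u @ v \<in> jacobi_231 S"
      using p uv jacobi_231_Cons_append_iff[OF bounds] length_jacobi_231[OF uv(2)] by simp
    ultimately show ?thesis by (simp add: split_def p(1))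
  qed
  have join_split: "?join (split w) = w \<and> split w \<in> ?D" if w: "w \<in> jacobi_231 S" for w
  proof -
    from w assms obtain f r where fr: "w = f # r"
      by (cases w) (auto dest: set_jacobi_231)
    define u v where "u = filter (\<lambda>x. x < f) r" and "v = filter (\<lambda>x. f < x) r"
    have bounds: "\<forall>x\<in>set u. x < f" "\<forall>y\<in>set v. f < y" by (simp_all add: u_def v_def)
    have r: "r = u @ v"
      using jacobi_231_Cons_eq_append w unfolding fr u_def v_def by blast
    have "split w = (f, u, v)" by (simp add: split_def fr u_def v_def)
    moreover have "(f, u, v) \<in> ?D"
      using w jacobi_231_Cons_append_iff[OF bounds, of S] length_jacobi_231[of v]
      by (auto simp: fr r)
    ultimately show ?thesis by (simp add: fr r)
  qed
  show ?thesis
    by (rule bij_betw_byWitness[where f' = split]) (use split_join join_split in blast)+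
qed

lemma sum_jacobi_231_first_letter:
  fixes g :: "nat list \<Rightarrow> 'a :: comm_monoid_add"
  assumes "finite S" "S \<noteq> {}"
  shows "(\<Sum>w\<in>jacobi_231 S. g w) = (\<Sum>f | f \<in> S \<and> even (card {x \<in> S. f < x}).
    \<Sum>u\<in>jacobi_231 {x \<in> S. x < f}. \<Sum>v\<in>jacobi_231 {x \<in> S. f < x}. g (f # u @ v))"
  using assms
  by (simp add: sum.Sigma sum.cartesian_product case_prod_unfold
      flip: sum.reindex_bij_betw[OF bij_betw_jacobi_231_first_letter[OF assms(2)]])

lemma sum_jacobi_231_greaterThanAtMost:
  fixes g :: "nat list \<Rightarrow> 'a :: comm_monoid_add"
  shows "(\<Sum>v\<in>jacobi_231 {f<..f + m}. g v) = (\<Sum>v\<in>jacobi_231 {1..m}. g (map (\<lambda>x. x + f) v))"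
proof -
  have "(\<lambda>x. x + f) ` {1..m} = {1 + f..m + f}" by (rule image_add_atLeastAtMost')
  also have "\<dots> = {f<..f + m}" by auto
  finally have "jacobi_231 {f<..f + m} = map (\<lambda>x. x + f) ` jacobi_231 {1..m}"
    using jacobi_231_image[of "\<lambda>x. x + f" "{1..m}"] by (simp add: strict_mono_def)
  then show ?thesis by (simp add: sum.reindex inj_on_subset[OF inj_mapI] o_def)
qed

definition glue :: "nat list \<Rightarrow> nat list \<Rightarrow> nat list" where
  "glue u v = Suc (length u) # u @ map (\<lambda>x. x + Suc (length u)) v"

lemma sum_jacobi_231_Suc:
  fixes g :: "nat list \<Rightarrow> 'a :: comm_monoid_add"
  shows "(\<Sum>w\<in>jacobi_231 {1..Suc n}. g w) =
    (\<Sum>j\<le>n div 2. \<Sum>u\<in>jacobi_231 {1..n - 2 * j}. \<Sum>v\<in>jacobi_231 {1..2 * j}. g (glue u v))"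
proof -
  have nonempty: "{1..Suc n} \<noteq> {}" by simp
  have above: "{x \<in> {1..Suc n}. f < x} = {f<..Suc n}" if "f \<in> {1..Suc n}" for f
    using that by auto
  have "(\<Sum>w\<in>jacobi_231 {1..Suc n}. g w) = (\<Sum>f | f \<in> {1..Suc n} \<and> even (Suc n - f).
      \<Sum>u\<in>jacobi_231 {x \<in> {1..Suc n}. x < f}. \<Sum>v\<in>jacobi_231 {f<..Suc n}. g (f # u @ v))"
    unfolding sum_jacobi_231_first_letter[OF finite_atLeastAtMost nonempty]
    by (intro sum.cong) (simp_all only: above card_greaterThanAtMost mem_Collect_eq cong: conj_cong)
  also have "\<dots> = (\<Sum>j\<le>n div 2. \<Sum>u\<in>jacobi_231 {1..n - 2 * j}.
      \<Sum>v\<in>jacobi_231 {1..2 * j}. g (glue u v))"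
  proof (rule sum.reindex_bij_witness[of _ "\<lambda>j. Suc (n - 2 * j)" "\<lambda>f. (Suc n - f) div 2"])
    fix f assume f: "f \<in> {f. f \<in> {1..Suc n} \<and> even (Suc n - f)}"
    define j where "j = (Suc n - f) div 2"
    have "even (Suc n - f)" using f by blast
    then have j: "2 * j = Suc n - f" by (simp only: j_def dvd_mult_div_cancel)
    then show "Suc (n - 2 * ((Suc n - f) div 2)) = f" and "(Suc n - f) div 2 \<in> {..n div 2}"
      using f by (auto simp flip: j_def)
    have f_eq: "f = Suc (n - 2 * j)" using f j by auto
    then have below_f: "{x \<in> {1..Suc n}. x < f} = {1..n - 2 * j}" by auto
    have above_f: "{f<..Suc n} = {f<..f + 2 * j}" using f j by auto
    have "glue u v = f # u @ map (\<lambda>x. x + f) v" if "u \<in> jacobi_231 {1..n - 2 * j}" for u v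
      using length_jacobi_231[OF that] by (simp add: glue_def f_eq)
    then show "(\<Sum>u\<in>jacobi_231 {1..n - 2 * ((Suc n - f) div 2)}.
        \<Sum>v\<in>jacobi_231 {1..2 * ((Suc n - f) div 2)}. g (glue u v)) =
      (\<Sum>u\<in>jacobi_231 {x \<in> {1..Suc n}. x < f}. \<Sum>v\<in>jacobi_231 {f<..Suc n}. g (f # u @ v))"
      unfolding j_def[symmetric] below_f above_f sum_jacobi_231_greaterThanAtMost
      by (intro sum.cong refl) simp
  qed auto
  finally show ?thesis .
qed

section \<open>Linear and algebraic equations for power series\<close>

unbundle fps_syntax

lemma fps_linear_solution_nth:
  fixes Q :: "'a :: comm_semiring_1 fps"
  assumes "Q = fps_const c + fps_X * U * Q"
  shows "(V * Q) $ n = c * (\<Sum>m\<le>n. (V * U ^ (n - m)) $ m)"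
proof (induction n arbitrary: V)
  case 0
  have "Q $ 0 = c" by (subst assms) simp
  then show ?case by (simp add: mult.commute)
next
  case (Suc n)
  have "V * Q = V * (fps_const c + fps_X * U * Q)"
    using assms by (rule arg_cong)
  also have "\<dots> = fps_const c * V + fps_X * (V * U * Q)"
    by (simp add: algebra_simps)
  finally have "(V * Q) $ Suc n = c * V $ Suc n + c * (\<Sum>m\<le>n. (V * U * U ^ (n - m)) $ m)"
    using Suc.IH[of "V * U"] by simp
  also have "(\<Sum>m\<le>n. (V * U * U ^ (n - m)) $ m) = (\<Sum>m\<le>n. (V * U ^ (Suc n - m)) $ m)"
    by (intro sum.cong) (simp_all add: Suc_diff_le mult.assoc)
  finally show ?case by (simp add: distrib_left add.commute)
qed

fun raney :: "nat \<Rightarrow> nat \<Rightarrow> nat \<Rightarrow> nat" where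
  "raney p r 0 = 1"
| "raney p 0 (Suc m) = 0"
| "raney p (Suc r) (Suc m) = raney p r (Suc m) + raney p (r + p) m"

text \<open>Stated without division, because \<open>raney p 0 0 = 1\<close> while the quotient would be \<open>0 / 0 = 0\<close>.\<close>

lemma raney_closed_form: "(p * m + r) * raney p r m = r * (p * m + r choose m)"
proof (induction p r m rule: raney.induct)
  case (3 p r m)
  define N where "N = p * Suc m + r"
  let ?C = "Suc N choose Suc m"
  have N_eqs: "p * m + (r + p) = N" "p * Suc m + Suc r = Suc N" by (simp_all add: N_def)
  show ?case
  proof (cases "N = 0")
    case True
    then have "p = 0" "r = 0" by (simp_all add: N_def)
    then show ?thesis by (cases m) simp_all
  next
    case False
    have "N * (Suc N * raney p (Suc r) (Suc m)) =
        Suc N * (N * raney p r (Suc m) + N * raney p (r + p) m)"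
      by (simp add: algebra_simps)
    also have "\<dots> = Suc N * (r * (N choose Suc m) + (r + p) * (N choose m))"
      using "3.IH" by (simp only: N_eqs N_def[symmetric])
    also have "\<dots> = Suc N * r * ?C + p * (Suc N * (N choose m))"
      by (simp add: algebra_simps)
    also have "\<dots> = (Suc N * r + p * Suc m) * ?C"
      unfolding Suc_times_binomial[symmetric] by (simp add: algebra_simps del: binomial_Suc_Suc)
    also have "\<dots> = N * (Suc r * ?C)"
      by (simp add: N_def algebra_simps del: binomial_Suc_Suc)
    finally show ?thesis unfolding N_eqs using False by simp
  qed
qed simp_all

lemma fps_power_nth_eq_raney:
  fixes e :: "'a :: comm_semiring_1 fps"
  assumes "e = 1 + fps_X * fps_const c * e ^ p"
  shows "(e ^ r) $ m = of_nat (raney p r m) * c ^ m"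
  using assms
proof (induction p r m rule: raney.induct)
  case (1 p r)
  have "e $ 0 = 1" by (subst 1) (simp add: mult.assoc)
  then show ?case by (simp add: fps_power_zeroth)
next
  case (3 p r m)
  have "e ^ Suc r = e ^ r * e" by (rule power_Suc2)
  also have "\<dots> = e ^ r * (1 + fps_X * fps_const c * e ^ p)"
    using 3 by (intro arg_cong[where f = "(*) (e ^ r)"])
  also have "\<dots> = e ^ r + fps_X * (fps_const c * e ^ (r + p))"
    by (simp add: algebra_simps power_add)
  finally have "(e ^ Suc r) $ Suc m = (e ^ r) $ Suc m + c * (e ^ (r + p)) $ m"
    by simp
  with 3 show ?case by (simp add: algebra_simps)
qed simp

section \<open>Generating functions\<close>

definition weight_sum :: "(nat list \<Rightarrow> 'a :: comm_monoid_add) \<Rightarrow> nat \<Rightarrow> 'a" where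
  "weight_sum g m = (\<Sum>w\<in>jacobi_231 {1..m}. g w)"

text \<open>The last letter of \<open>glue u v\<close> comes from \<open>v\<close>, or from \<open>u\<close> if \<open>v\<close> is empty; hence two
  products.\<close>

lemma weight_sum_Suc_glue:
  fixes g :: "nat list \<Rightarrow> 'a :: comm_semiring_1"
  assumes "\<And>u v. g (glue u v) = a u * b v + c u * d v"
  shows "weight_sum g (Suc n) = (\<Sum>j\<le>n div 2.
    weight_sum a (n - 2 * j) * weight_sum b (2 * j) +
    weight_sum c (n - 2 * j) * weight_sum d (2 * j))"
  by (simp only: weight_sum_def sum_jacobi_231_Suc assms sum.distrib sum_product)

definition weight_fps :: "nat \<Rightarrow> (nat list \<Rightarrow> 'a :: comm_monoid_add) \<Rightarrow> 'a fps" where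
  "weight_fps r g = Abs_fps (\<lambda>n. weight_sum g (2 * n + r))"

lemma weight_fps_zero [simp]: "weight_fps r (\<lambda>_. 0) = 0"
  by (rule fps_ext) (simp add: weight_fps_def weight_sum_def)

lemma weight_fps_add: "weight_fps r (\<lambda>w. g w + h w) = weight_fps r g + weight_fps r h"
  by (rule fps_ext) (simp add: weight_fps_def weight_sum_def sum.distrib)

lemma weight_fps_mult_left:
  fixes c :: "'a :: comm_semiring_1"
  shows "weight_fps r (\<lambda>w. c * g w) = fps_const c * weight_fps r g"
  by (rule fps_ext) (simp add: weight_fps_def weight_sum_def sum_distrib_left)

lemma weight_fps_of_bool_Nil:
  "weight_fps r (\<lambda>w. of_bool (w = [])) = (of_bool (r = 0) :: 'a :: comm_semiring_1 fps)"
proof (rule fps_ext)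
  fix n
  have "weight_sum (\<lambda>w. of_bool (w = [])) m = (of_bool (m = 0) :: 'a)" for m
  proof (cases m)
    case (Suc k)
    then have "w \<noteq> []" if "w \<in> jacobi_231 {1..m}" for w
      using length_jacobi_231[OF that] by auto
    with Suc show ?thesis by (simp add: weight_sum_def)
  qed (simp add: weight_sum_def)
  then show "weight_fps r (\<lambda>w. of_bool (w = [])) $ n = (of_bool (r = 0) :: 'a fps) $ n"
    by (simp add: weight_fps_def)
qed

lemma weight_sum_Suc_glue_nth:
  fixes g :: "nat list \<Rightarrow> 'a :: comm_semiring_1"
  assumes "\<And>u v. g (glue u v) = a u * b v + c u * d v" and "r < 2"
  shows "weight_sum g (Suc (2 * n + r)) =
    (weight_fps r a * weight_fps 0 b + weight_fps r c * weight_fps 0 d) $ n"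
proof -
  have convolution: "(\<Sum>j\<le>n. weight_sum a (2 * n + r - 2 * j) * weight_sum b (2 * j)) =
      (weight_fps r a * weight_fps 0 b) $ n" for a b :: "nat list \<Rightarrow> 'a"
  proof -
    have "2 * n + r - 2 * j = 2 * (n - j) + r" if "j \<le> n" for j
      using that by simp
    then show ?thesis
      unfolding mult.commute[of "weight_fps r a"] fps_mult_nth atMost_atLeast0
      by (intro sum.cong) (simp_all add: weight_fps_def mult.commute)
  qed
  have "(2 * n + r) div 2 = n" using assms(2) by simp
  then show ?thesis
    using weight_sum_Suc_glue[of g a b c d "2 * n + r", OF assms(1)]
    by (simp only: convolution sum.distrib fps_add_nth)
qed

lemma weight_fps_1_glue:
  fixes g :: "nat list \<Rightarrow> 'a :: comm_semiring_1"
  assumes "\<And>u v. g (glue u v) = a u * b v + c u * d v"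
  shows "weight_fps 1 g = weight_fps 0 a * weight_fps 0 b + weight_fps 0 c * weight_fps 0 d"
  using weight_sum_Suc_glue_nth[of g a b c d 0, OF assms]
  by (intro fps_ext) (simp add: weight_fps_def)

lemma weight_fps_0_glue:
  fixes g :: "nat list \<Rightarrow> 'a :: comm_semiring_1"
  assumes "\<And>u v. g (glue u v) = a u * b v + c u * d v"
  shows "weight_fps 0 g = fps_const (g []) +
    fps_X * (weight_fps 1 a * weight_fps 0 b + weight_fps 1 c * weight_fps 0 d)"
proof (rule fps_ext)
  fix n
  show "weight_fps 0 g $ n = (fps_const (g []) +
      fps_X * (weight_fps 1 a * weight_fps 0 b + weight_fps 1 c * weight_fps 0 d)) $ n"
    using weight_sum_Suc_glue_nth[of g a b c d 1, OF assms]
    by (cases n) (simp_all add: weight_fps_def weight_sum_def)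
qed

definition length_weight :: "'a \<Rightarrow> nat list \<Rightarrow> 'a :: comm_semiring_1" where
  "length_weight t w = t ^ length w"

definition last_weight :: "'a \<Rightarrow> nat list \<Rightarrow> 'a :: comm_semiring_1" where
  "last_weight t w = (if w = [] then 0 else t ^ last w)"

definition even_fps :: "'a \<Rightarrow> 'a :: comm_semiring_1 fps" where
  "even_fps t = weight_fps 0 (length_weight t)"

definition last_even_fps :: "'a \<Rightarrow> 'a :: comm_semiring_1 fps" where
  "last_even_fps t = weight_fps 0 (last_weight t)"

definition last_odd_fps :: "'a \<Rightarrow> 'a :: comm_semiring_1 fps" where
  "last_odd_fps t = weight_fps 1 (last_weight t)"

lemma length_weight_glue:
  "length_weight t (glue u v) = (t * length_weight t u) * length_weight t v"
  by (simp add: length_weight_def glue_def power_add mult.assoc)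

lemma last_weight_glue:
  "last_weight t (glue u v) = (t * length_weight t u) * last_weight t v +
    (t * of_bool (u = []) + last_weight t u) * of_bool (v = [])"
  by (simp add: last_weight_def length_weight_def glue_def last_map power_add mult_ac)

lemma weight_fps_1_length_weight: "weight_fps 1 (length_weight t) = fps_const t * even_fps t ^ 2"
proof -
  have "weight_fps 1 (length_weight t) =
      weight_fps 0 (\<lambda>u. t * length_weight t u) * weight_fps 0 (length_weight t) +
      weight_fps 0 (\<lambda>_. 0) * weight_fps 0 (\<lambda>_. 0)"
    by (rule weight_fps_1_glue) (simp add: length_weight_glue)
  then show ?thesis
    by (simp add: weight_fps_mult_left even_fps_def power2_eq_square mult.assoc)
qed

lemma even_fps_cubic: "even_fps t = 1 + fps_X * fps_const (t ^ 2) * even_fps t ^ 3"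
proof -
  have "weight_fps 0 (length_weight t) = fps_const (length_weight t []) +
      fps_X * (weight_fps 1 (\<lambda>u. t * length_weight t u) * weight_fps 0 (length_weight t) +
        weight_fps 1 (\<lambda>_. 0) * weight_fps 0 (\<lambda>_. 0))"
    by (rule weight_fps_0_glue) (simp add: length_weight_glue)
  also have "\<dots> = 1 + fps_X * (fps_const t * weight_fps 1 (length_weight t) * even_fps t)"
    by (simp add: weight_fps_mult_left length_weight_def[of t "[]"] even_fps_def)
  also have "fps_const t * weight_fps 1 (length_weight t) * even_fps t =
      fps_const (t ^ 2) * even_fps t ^ 3"
    unfolding weight_fps_1_length_weight
    by (simp add: power2_eq_square power3_eq_cube mult_ac flip: fps_const_mult)
  finally show ?thesis unfolding even_fps_def[symmetric] by (simp only: mult.assoc)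
qed

lemma last_odd_fps_eq:
  "last_odd_fps t = fps_const t + (1 + fps_const t * even_fps t) * last_even_fps t"
proof -
  have "last_odd_fps t =
      weight_fps 0 (\<lambda>u. t * length_weight t u) * weight_fps 0 (last_weight t) +
      weight_fps 0 (\<lambda>u. t * of_bool (u = []) + last_weight t u) *
        weight_fps 0 (\<lambda>v. of_bool (v = []))"
    unfolding last_odd_fps_def by (rule weight_fps_1_glue) (rule last_weight_glue)
  then show ?thesis
    by (simp add: weight_fps_mult_left weight_fps_add weight_fps_of_bool_Nil even_fps_def
        last_even_fps_def algebra_simps)
qed

lemma last_even_fps_eq:
  "last_even_fps t = fps_X * (fps_const (t ^ 2) * even_fps t ^ 2 * last_even_fps t + last_odd_fps t)"
proof -
  have "last_even_fps t = fps_const (last_weight t []) +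
      fps_X * (weight_fps 1 (\<lambda>u. t * length_weight t u) * weight_fps 0 (last_weight t) +
        weight_fps 1 (\<lambda>u. t * of_bool (u = []) + last_weight t u) *
          weight_fps 0 (\<lambda>v. of_bool (v = [])))"
    unfolding last_even_fps_def by (rule weight_fps_0_glue) (rule last_weight_glue)
  also have "\<dots> = fps_X *
      (fps_const t * weight_fps 1 (length_weight t) * last_even_fps t + last_odd_fps t)"
    by (simp add: weight_fps_mult_left weight_fps_add weight_fps_of_bool_Nil
        last_weight_def[of t "[]"] last_even_fps_def last_odd_fps_def)
  finally show ?thesis
    unfolding weight_fps_1_length_weight
    by (simp add: power2_eq_square mult.assoc flip: fps_const_mult)
qed

lemma last_even_fps_eq_last_odd_fps:
  fixes t :: "'a :: {comm_semiring_1, cancel_comm_monoid_add}"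
  shows "last_even_fps t = fps_X * even_fps t * last_odd_fps t"
proof -
  let ?e = "even_fps t" and ?P = "last_even_fps t" and ?Q = "last_odd_fps t"
  let ?R = "fps_X * fps_const (t ^ 2) * ?e ^ 3 * ?P"
  have "?P + ?R = (1 + fps_X * fps_const (t ^ 2) * ?e ^ 3) * ?P"
    by (simp add: distrib_right)
  also have "\<dots> = ?e * ?P"
    using even_fps_cubic[of t] by simp
  also have "\<dots> = ?e * (fps_X * (fps_const (t ^ 2) * ?e ^ 2 * ?P + ?Q))"
    using last_even_fps_eq[of t] by (rule arg_cong)
  also have "\<dots> = fps_X * ?e * ?Q + ?R"
    by (simp add: algebra_simps power2_eq_square power3_eq_cube)
  finally show ?thesis by simp
qed

section \<open>Coefficients\<close>

lemma even_fps_power_mult_nth: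
  "(even_fps t ^ s * (even_fps t * (1 + fps_const t * even_fps t)) ^ j) $ m =
    (\<Sum>i\<le>j. of_nat ((j choose i) * raney 3 (s + j + i) m) * t ^ (2 * m + i))"
proof -
  have summand: "of_nat (j choose i) * (fps_const t * even_fps t) ^ i * even_fps t ^ (s + j) =
      fps_const (of_nat (j choose i) * t ^ i) * even_fps t ^ (s + j + i)" for i
    by (simp add: power_mult_distrib power_add mult_ac
        flip: fps_of_nat fps_const_mult)
  have "even_fps t ^ s * (even_fps t * (1 + fps_const t * even_fps t)) ^ j =
      (fps_const t * even_fps t + 1) ^ j * even_fps t ^ (s + j)"
    by (simp add: power_mult_distrib power_add add.commute mult_ac)
  also have "\<dots> = (\<Sum>i\<le>j. fps_const (of_nat (j choose i) * t ^ i) * even_fps t ^ (s + j + i))"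
    by (simp add: binomial_ring sum_distrib_right summand)
  finally show ?thesis
    by (simp only: fps_sum_nth fps_mult_left_const_nth fps_power_nth_eq_raney[OF even_fps_cubic])
      (simp add: power_add mult_ac flip: power_mult)
qed

lemma even_fps_power_mult_last_odd_fps_nth:
  "(even_fps t ^ s * last_odd_fps t) $ n = (\<Sum>m\<le>n. \<Sum>i\<le>n - m.
    of_nat ((n - m choose i) * raney 3 (s + (n - m) + i) m) * t ^ (2 * m + 1 + i))"
  for t :: "'a :: {comm_semiring_1, cancel_comm_monoid_add}"
proof -
  let ?e = "even_fps t" and ?Q = "last_odd_fps t"
  have "(1 + fps_const t * ?e) * last_even_fps t =
      fps_X * (?e * (1 + fps_const t * ?e)) * ?Q"
    unfolding last_even_fps_eq_last_odd_fps by (simp add: mult_ac)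
  then have "?Q = fps_const t + fps_X * (?e * (1 + fps_const t * ?e)) * ?Q"
    using last_odd_fps_eq[of t] by simp
  from fps_linear_solution_nth[OF this, of "?e ^ s" n] show ?thesis
    by (simp add: even_fps_power_mult_nth sum_distrib_left mult_ac)
qed

lemma coeff_weight_sum_last_weight:
  "coeff (weight_sum (last_weight (monom 1 1)) m) k = jlast [2,3,1] m k"
proof -
  have "coeff (weight_sum (last_weight (monom 1 1)) m) k =
      (\<Sum>w\<in>jacobi_231 {1..m}. if w \<noteq> [] \<and> last w = k then 1 else 0 :: nat)"
    unfolding weight_sum_def coeff_sum
    by (intro sum.cong) (auto simp: last_weight_def monom_power)
  also have "\<dots> = card (jacobi_231 {1..m} \<inter> {w. w \<noteq> [] \<and> last w = k})"
    by (simp add: sum.If_cases)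
  also have "\<dots> = jlast [2,3,1] m k"
    unfolding jlast_def jacobi_231_def by (rule arg_cong[of _ _ card]) blast
  finally show ?thesis .
qed

definition jlast_summand :: "nat \<Rightarrow> nat \<Rightarrow> nat \<Rightarrow> nat \<Rightarrow> nat" where
  "jlast_summand n k j m = (if 2 * m < k
    then (j choose (k - 2 * m - 1)) * raney 3 (n - m + (k - 2 * m - 1)) m else 0)"

lemma coeff_even_fps_power_mult_last_odd_fps_nth:
  "coeff ((even_fps (monom 1 1) ^ s * last_odd_fps (monom 1 1)) $ n) k =
    (\<Sum>m\<le>n. jlast_summand (s + n) k (n - m) m)"
proof -
  have monom_eq: "of_nat a * monom 1 1 ^ b = (monom a b :: nat poly)" for a b
    by (simp add: monom_power of_nat_monom mult_monom)
  have "(\<Sum>i\<le>n - m. coeff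
        (monom ((n - m choose i) * raney 3 (s + (n - m) + i) m) (2 * m + 1 + i)) k) =
      jlast_summand (s + n) k (n - m) m" (is "?sum = _") if "m \<le> n" for m
  proof -
    have "?sum = (\<Sum>i\<le>n - m. if i = k - 2 * m - 1
        then if 2 * m < k then (n - m choose i) * raney 3 (s + (n - m) + i) m else 0 else 0)"
      by (intro sum.cong) auto
    then show ?thesis
      using that by (simp add: jlast_summand_def binomial_eq_0)
  qed
  then show ?thesis
    unfolding even_fps_power_mult_last_odd_fps_nth coeff_sum monom_eq by (intro sum.cong) auto
qed

lemma jlast_231_even:
  assumes "n \<ge> 1"
  shows "jlast [2,3,1] (2 * n) k = (\<Sum>m = 0..n - 1. jlast_summand n k (n - 1 - m) m)"
proof -
  obtain n' where n: "n = Suc n'" using assms by (cases n) auto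
  let ?t = "monom 1 1 :: nat poly"
  have "weight_sum (last_weight ?t) (2 * n) = last_even_fps ?t $ Suc n'"
    by (simp add: last_even_fps_def weight_fps_def n)
  also have "\<dots> = (even_fps ?t ^ 1 * last_odd_fps ?t) $ n'"
    unfolding last_even_fps_eq_last_odd_fps by (simp add: mult.assoc)
  finally show ?thesis
    unfolding coeff_weight_sum_last_weight[symmetric]
    by (simp only: coeff_even_fps_power_mult_last_odd_fps_nth) (simp add: n atMost_atLeast0)
qed

lemma jlast_231_odd:
  assumes "n \<ge> 1"
  shows "jlast [2,3,1] (2 * n + 1) k = (\<Sum>m = 0..n - 1. jlast_summand n k (n - m) m)"
proof -
  have "jlast [2,3,1] (2 * n + 1) k = (\<Sum>m\<le>n. jlast_summand n k (n - m) m)"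
    using coeff_even_fps_power_mult_last_odd_fps_nth[of 0 n k]
    unfolding coeff_weight_sum_last_weight[symmetric]
    by (simp add: last_odd_fps_def weight_fps_def)
  moreover have "jlast_summand n k 0 n = 0"
    using assms by (cases "k = 2 * n + 1"; cases n) (auto simp: jlast_summand_def binomial_eq_0)
  ultimately show ?thesis
    using assms by (cases n) (simp_all add: atMost_atLeast0)
qed

lemma int_binomial_of_nat: "int_binomial (int a) (int b) = a choose b"
  by (simp add: int_binomial_def binomial_eq_0)

lemma real_jlast_summand:
  assumes "m \<le> n" "n \<ge> 1" "k \<ge> 1"
  shows "real (jlast_summand n k j m) =
    (real n + real k - 3 * real m - 1) / (real n + real k - 1)
      * real (int_binomial (int j) (int k - 2 * int m - 1))
      * real (int_binomial (int n + int k - 1) (int m))"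
proof (cases "2 * m < k")
  case True
  define r where "r = n - m + (k - 2 * m - 1)"
  have total: "3 * m + r = n + k - 1" using assms True by (simp add: r_def)
  have real_r_N: "real r = real n + real k - 3 * real m - 1" "real (n + k - 1) = real n + real k - 1"
    using assms True by (simp_all add: r_def)
  have "real (n + k - 1) * real (raney 3 r m) = real r * real (n + k - 1 choose m)"
    using raney_closed_form[of 3 m r] unfolding total by (simp only: flip: of_nat_mult)
  moreover have "real n + real k - 1 \<noteq> 0" using assms by simp
  ultimately have raney: "real (raney 3 r m) =
      (real n + real k - 3 * real m - 1) / (real n + real k - 1) * real (n + k - 1 choose m)"
    unfolding real_r_N by (simp add: field_simps)
  have lower_upper: "int k - 2 * int m - 1 = int (k - 2 * m - 1)" "int n + int k - 1 = int (n + k - 1)"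
    using True assms by simp_all
  show ?thesis
    unfolding jlast_summand_def lower_upper int_binomial_of_nat r_def[symmetric]
    using True raney by simp
next
  case False
  then show ?thesis by (simp add: jlast_summand_def int_binomial_def)
qed

theorem theorem5p11:
  fixes n k :: nat
  assumes "n \<ge> 1" and "k \<ge> 1"
  shows "real (jlast [2,3,1] (2 * n) k) =
           (\<Sum>m = 0..n - 1. (real n + real k - 3 * real m - 1) / (real n + real k - 1)
              * real (int_binomial (int n - int m - 1) (int k - 2 * int m - 1))
              * real (int_binomial (int n + int k - 1) (int m)))
       \<and> real (jlast [2,3,1] (2 * n + 1) k) =
           (\<Sum>m = 0..n - 1. (real n + real k - 3 * real m - 1) / (real n + real k - 1)
              * real (int_binomial (int n - int m) (int k - 2 * int m - 1))
              * real (int_binomial (int n + int k - 1) (int m)))"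
proof -
  have "int (n - 1 - m) = int n - int m - 1" "int (n - m) = int n - int m" "m \<le> n"
    if "m \<in> {0..n - 1}" for m
    using that assms(1) by auto
  then show ?thesis
    unfolding jlast_231_even[OF assms(1)] jlast_231_odd[OF assms(1)] of_nat_sum
    by (intro conjI sum.cong refl) (simp_all only: real_jlast_summand assms)
qed

end
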